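(* Let $\mathbb{T}$ be a time scale, let $\alpha,\beta\in\mathbb{T}$ with $\alpha<\beta$, and let $\psi,\phi:[\alpha,\beta]_{\mathbb{T}}\to\mathbb{R}$ be Nabla-integrable functions with $\phi>0$. If $\psi/\phi$ is increasing (respectively, decreasing) on $[\alpha,\beta]_{\mathbb{T}}$, then the function $$s\mapsto \frac{\int_{\alpha}^s \psi(\upsilon)\,\nabla\upsilon}{\int_{\alpha}^s \phi(\upsilon)\,\nabla\upsilon}$$ is increasing (respectively, decreasing) for $s\in[\alpha,\beta]_{\mathbb{T}}$, $s>\alpha$.
   Context: A time scale $\mathbb{T}$ is a nonempty closed subset of $\mathbb{R}$, and $[\alpha,\beta]_{\mathbb{T}}=[\alpha,\beta]\cap\mathbb{T}$. The Nabla integral $\int_a^b f(\upsilon)\,\nabla\upsilon$ ($a\le b$ in $\mathbb{T}$) is the standard one, i.e. the integral of $f$ over $(a,b]\cap\mathbb{T}$ with respect to the Nabla measure $\mu_\nabla$ on $\mathbb{T}$, determined by $\mu_\nabla((c,d]\cap\mathbb{T})=d-c$ for $c\le d$ in $\mathbb{T}$. "Increasing" and "decreasing" are meant in the non-strict sense. *)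

theory Defs
  imports "HOL-Analysis.Analysis"
begin

definition time_scale :: "real set \<Rightarrow> bool" where
  "time_scale T \<longleftrightarrow> closed T \<and> T \<noteq> {}"

text \<open>The prescribed values do not determine the mass of the point \<open>Min T\<close> (if it exists), but
  no interval \<open>{a<..b}\<close> with \<open>a \<in> T\<close> contains that point. The measure is completed, so that
  integrability is understood in the sense of the Lebesgue (not just the Borel) nabla measure.\<close>

definition nabla_measure :: "real set \<Rightarrow> real measure" where
  "nabla_measure T = completion
     (extend_measure T {(c, d). c \<in> T \<and> d \<in> T \<and> c \<le> d}
        (\<lambda>(c, d). {c<..d} \<inter> T) (\<lambda>(c, d). ennreal (d - c)))"

definition nabla_integrable :: "real set \<Rightarrow> real \<Rightarrow> real \<Rightarrow> (real \<Rightarrow> real) \<Rightarrow> bool" where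
  "nabla_integrable T a b f \<longleftrightarrow> set_integrable (nabla_measure T) ({a<..b} \<inter> T) f"

definition nabla_integral :: "real set \<Rightarrow> real \<Rightarrow> real \<Rightarrow> (real \<Rightarrow> real) \<Rightarrow> real" where
  "nabla_integral T a b f = (LINT t:{a<..b} \<inter> T|nabla_measure T. f t)"

lemma space_nabla_measure: "space (nabla_measure T) = T"
  unfolding nabla_measure_def extend_measure_def by (auto simp: space_measure_of_conv)

text \<open>A measure with the prescribed values exists, so that \<^const>\<open>extend_measure\<close>
  attains them: one such measure is the image of the Lebesgue measure under the map sending \<open>x\<close> to the least
  element of \<open>T\<close> that is at least \<open>x\<close>.\<close>

lemma emeasure_nabla_measure_Ioc:
  assumes T: "time_scale T" and cd: "c \<in> T" "d \<in> T" "c \<le> d"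
  shows "{c<..d} \<inter> T \<in> sets (nabla_measure T)"
    and "emeasure (nabla_measure T) ({c<..d} \<inter> T) = ennreal (d - c)"
proof -
  define I where "I = {(c, d). c \<in> T \<and> d \<in> T \<and> c \<le> d}"
  define G where "G = (\<lambda>(c, d). {c<..d} \<inter> T)"
  define \<mu> where "\<mu> = (\<lambda>(c, d). ennreal (d - c :: real))"
  define M where "M = extend_measure T I G \<mu>"
  have GT: "G ` I \<subseteq> Pow T"
    by (auto simp: G_def)
  have sets_M: "sets M = sigma_sets T (G ` I)"
    unfolding M_def using GT by (rule sets_extend_measure)
  define D where "D = {x. \<exists>t\<in>T. x \<le> t}"
  define g where "g x = Inf {t \<in> T. x \<le> t}" for x
  have g_mem: "g x \<in> T" "x \<le> g x" if "x \<in> D" for x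
  proof -
    have "closed ({t \<in> T. x \<le> t})"
      using T closed_Int[of T "{x..}"] by (auto simp: time_scale_def Int_def)
    moreover have "{t \<in> T. x \<le> t} \<noteq> {}"
      using that by (auto simp: D_def)
    moreover have "bdd_below {t \<in> T. x \<le> t}"
      by (rule bdd_belowI[of _ x]) auto
    ultimately have "g x \<in> {t \<in> T. x \<le> t}"
      unfolding g_def by (intro closed_contains_Inf)
    then show "g x \<in> T" "x \<le> g x" by auto
  qed
  have g_le: "g x \<le> t" if "t \<in> T" "x \<le> t" for x t
    unfolding g_def using that by (intro cInf_lower bdd_belowI[of _ x]) auto
  have pre: "g -` ({a<..b} \<inter> T) \<inter> D = {a<..b}" if "a \<in> T" "b \<in> T" for a b
  proof -
    have "x \<in> D \<and> g x \<in> {a<..b} \<inter> T \<longleftrightarrow> x \<in> {a<..b}" for x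
    proof (cases "x \<in> D")
      case True
      then show ?thesis
        using g_mem[of x] g_le[of a x] g_le[of b x] that by fastforce
    next
      case False
      then show ?thesis
        using that by (auto simp: D_def)
    qed
    then show ?thesis by blast
  qed
  have "is_interval D"
    unfolding D_def is_interval_1 by (blast intro: order_trans)
  then have D: "D \<in> sets lborel"
    using real_interval_borel_measurable by simp
  define L where "L = restrict_space lborel D"
  have space_L: "space L = D"
    by (simp add: L_def space_restrict_space)
  have g_meas: "g \<in> measurable L (sigma T (G ` I))"
  proof (rule measurable_measure_of[OF GT])
    show "g \<in> space L \<rightarrow> T"
      using g_mem by (auto simp: space_L)
    show "g -` y \<inter> space L \<in> sets L" if "y \<in> G ` I" for y
    proof -
      from that obtain a b where ab: "a \<in> T" "b \<in> T" "y = {a<..b} \<inter> T"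
        by (auto simp: G_def I_def)
      have eq: "g -` y \<inter> space L = {a<..b}"
        using pre[OF ab(1,2)] ab(3) by (simp add: space_L)
      then have "{a<..b} \<subseteq> D"
        by (auto simp: space_L)
      then show ?thesis
        unfolding eq using D by (simp add: L_def sets_restrict_space_iff)
    qed
  qed
  define N where "N = distr L (sigma T (G ` I)) g"
  have sets_N: "sets N = sets M"
    using GT by (simp add: N_def sets_M)
  have vals: "emeasure N (G i) = \<mu> i" if "i \<in> I" for i
  proof -
    from that obtain a b where i: "i = (a, b)" "a \<in> T" "b \<in> T" "a \<le> b"
      by (cases i) (auto simp: I_def)
    have "G i \<in> sets (sigma T (G ` I))"
      using GT that by (auto intro: sigma_sets.Basic)
    then have "emeasure N (G i) = emeasure L (g -` G i \<inter> space L)"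
      unfolding N_def by (rule emeasure_distr[OF g_meas])
    also have eq: "g -` G i \<inter> space L = {a<..b}"
      using pre[OF i(2,3)] i(1) by (simp add: space_L G_def)
    also have "emeasure L {a<..b} = emeasure lborel {a<..b}"
      unfolding L_def using D eq by (intro emeasure_restrict_space) (auto simp: space_L)
    finally show ?thesis
      using i by (simp add: \<mu>_def)
  qed
  have cdI: "(c, d) \<in> I"
    using cd by (simp add: I_def)
  have "emeasure M (G (c, d)) = \<mu> (c, d)"
  proof (rule emeasure_extend_measure[OF M_def _ GT _ _ cdI])
    show "emeasure N (G i) = \<mu> i" if "i \<in> I" for i
      using that by (rule vals)
    show "positive (sets M) (emeasure N)"
      using emeasure_positive[of N] by (simp add: sets_N)
    show "countably_additive (sets M) (emeasure N)"
      using emeasure_countably_additive[of N] by (simp add: sets_N)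
  qed
  moreover have G_M: "G (c, d) \<in> sets M"
    unfolding sets_M using cdI by (intro sigma_sets.Basic) auto
  moreover have "nabla_measure T = completion M"
    unfolding nabla_measure_def M_def I_def G_def \<mu>_def ..
  ultimately show "{c<..d} \<inter> T \<in> sets (nabla_measure T)"
    and "emeasure (nabla_measure T) ({c<..d} \<inter> T) = ennreal (d - c)"
    by (auto simp: G_def \<mu>_def)
qed

end

theory Submission
  imports Defs
begin

text \<open>Let \<open>s < u\<close> and \<open>c = \<psi> s / \<phi> s\<close>. If \<open>\<psi> / \<phi>\<close> is increasing, then \<open>\<psi> \<le> c \<phi>\<close> on
  \<open>(\<alpha>, s]\<close> and \<open>\<psi> \<ge> c \<phi>\<close> on \<open>(s, u]\<close>; so the mean ratio over \<open>(\<alpha>, s]\<close> is at most \<open>c\<close>, that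
  over \<open>(s, u]\<close> at least \<open>c\<close>, and the ratio over \<open>(\<alpha>, u]\<close> is their mediant. The decreasing
  case follows by passing to \<open>- \<psi>\<close>.\<close>

text \<open>A nonnegative integrand with zero integral vanishes almost everywhere; being positive on
  all of \<open>S\<close>, it would force \<open>S\<close> to be null.\<close>

lemma set_integral_pos:
  fixes f :: "'a \<Rightarrow> real"
  assumes S: "S \<in> sets M" "emeasure M S \<noteq> 0"
    and f: "set_integrable M S f" "\<And>x. x \<in> S \<Longrightarrow> 0 < f x"
  shows "0 < (LINT x:S|M. f x)"
proof -
  have int: "integrable M (\<lambda>x. indicator S x *\<^sub>R f x)"
    using f(1) by (simp add: set_integrable_def)
  have nonneg: "0 \<le> indicator S x *\<^sub>R f x" for x
    using f(2)[of x] by (auto simp: indicator_def)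
  have "(\<integral>x. indicator S x *\<^sub>R f x \<partial>M) \<noteq> 0"
  proof
    assume "(\<integral>x. indicator S x *\<^sub>R f x \<partial>M) = 0"
    \<comment> \<open>Since \<open>f\<close> is only known to be integrable on \<open>S\<close>, the
      null set criterion is applied to the cut-off integrand. Its set integral carries the indicator
      twice, which is harmless by idempotence.\<close>
    then have "(LINT x:S|M. indicator S x *\<^sub>R f x) = 0"
      by (simp add: set_lebesgue_integral_def flip: mult.assoc indicator_inter_arith)
    then have "S \<in> null_sets M"
      using f(2) by (intro null_if_pos_func_has_zero_int[OF int S(1)]) auto
    with S(2) show False by auto
  qed
  moreover have "0 \<le> (\<integral>x. indicator S x *\<^sub>R f x \<partial>M)"
    using nonneg by (intro integral_nonneg_AE) auto
  ultimately show ?thesis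
    by (simp add: set_lebesgue_integral_def)
qed

text \<open>After cross-multiplication the claim is \<open>a * d \<le> c * b\<close>, and
  \<open>k * b * d\<close> lies between the two sides. Allowing \<open>d = 0\<close> covers an empty
  second interval.\<close>

lemma mediant_le:
  fixes a b c d k :: real
  assumes "0 < b" "0 \<le> d" "a \<le> k * b" "k * d \<le> c"
  shows "a / b \<le> (a + c) / (b + d)"
proof -
  have "a * d \<le> (k * b) * d"
    using assms by (intro mult_right_mono)
  also have "\<dots> = (k * d) * b"
    by simp
  also have "\<dots> \<le> c * b"
    using assms by (intro mult_right_mono) auto
  finally show ?thesis
    using assms by (simp add: field_simps)
qed

text \<open>The numerator has no sign condition, so the decreasing case can reuse this with
  \<open>- \<psi>\<close>.\<close>

lemma nabla_integral_ratio_mono: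
  assumes T: "time_scale T" and ab: "\<alpha> \<in> T" "\<beta> \<in> T" "\<alpha> < \<beta>"
    and \<psi>: "nabla_integrable T \<alpha> \<beta> \<psi>" and \<phi>: "nabla_integrable T \<alpha> \<beta> \<phi>"
    and pos: "\<And>t. t \<in> {\<alpha>..\<beta>} \<inter> T \<Longrightarrow> 0 < \<phi> t"
    and mono: "mono_on ({\<alpha>..\<beta>} \<inter> T) (\<lambda>t. \<psi> t / \<phi> t)"
  shows "mono_on ({\<alpha><..\<beta>} \<inter> T) (\<lambda>s. nabla_integral T \<alpha> s \<psi> / nabla_integral T \<alpha> s \<phi>)"
proof (rule mono_onI)
  fix s u
  assume s: "s \<in> {\<alpha><..\<beta>} \<inter> T" and u: "u \<in> {\<alpha><..\<beta>} \<inter> T" and su: "s \<le> u"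
  let ?M = "nabla_measure T" and ?L = "{\<alpha><..s} \<inter> T" and ?R = "{s<..u} \<inter> T"
  \<comment> \<open>This is the separating constant of the overview. The facts \<open>a\<close>,
    \<open>b\<close>, \<open>c\<close>, \<open>d\<close> below are named after the variables of
    \<open>mediant_le\<close> that they bound.\<close>
  define k where "k = \<psi> s / \<phi> s"
  have meas: "?L \<in> sets ?M" "?R \<in> sets ?M"
    using emeasure_nabla_measure_Ioc(1)[OF T] ab s u su by auto
  have int: "set_integrable ?M ?L f \<and> set_integrable ?M ?R f"
    if "nabla_integrable T \<alpha> \<beta> f" for f
    using that s u su meas unfolding nabla_integrable_def
    by (auto intro!: set_integrable_subset[of ?M "{\<alpha><..\<beta>} \<inter> T" f])
  have split: "nabla_integral T \<alpha> u f = (LINT t:?L|?M. f t) + (LINT t:?R|?M. f t)"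
    if "nabla_integrable T \<alpha> \<beta> f" for f
  proof -
    have "{\<alpha><..u} \<inter> T = ?L \<union> ?R"
      using s su by auto
    then show ?thesis
      unfolding nabla_integral_def
      using int[OF that] by (simp add: set_integral_Un disjoint_iff)
  qed
  \<comment> \<open>The mass is positive because \<open>\<alpha> < s\<close>, so \<open>?L\<close>
    is not null and the denominator is nonzero.\<close>
  have "emeasure ?M ?L = ennreal (s - \<alpha>)"
    using emeasure_nabla_measure_Ioc(2)[OF T, of \<alpha> s] ab s by auto
  then have b: "0 < (LINT t:?L|?M. \<phi> t)"
    using s meas int[OF \<phi>] by (intro set_integral_pos pos) auto
  \<comment> \<open>No strict bound is possible: \<open>?R\<close> is empty when
    \<open>s = u\<close>.\<close>
  have d: "0 \<le> (LINT t:?R|?M. \<phi> t)"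
    unfolding set_lebesgue_integral_def
    using s u by (intro integral_nonneg_AE AE_I2) (auto simp: indicator_def intro!: less_imp_le pos)
  have a: "(LINT t:?L|?M. \<psi> t) \<le> k * (LINT t:?L|?M. \<phi> t)"
  proof -
    have "\<psi> t \<le> k * \<phi> t" if "t \<in> ?L" for t
      using mono_onD[OF mono, of t s] pos[of t] s that by (auto simp: k_def pos_divide_le_eq)
    then have "(LINT t:?L|?M. \<psi> t) \<le> (LINT t:?L|?M. k * \<phi> t)"
      using int[OF \<psi>] int[OF \<phi>] by (intro set_integral_mono) auto
    then show ?thesis by simp
  qed
  have c: "k * (LINT t:?R|?M. \<phi> t) \<le> (LINT t:?R|?M. \<psi> t)"
  proof -
    have "k * \<phi> t \<le> \<psi> t" if "t \<in> ?R" for t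
      using mono_onD[OF mono, of s t] pos[of t] s u that by (auto simp: k_def pos_le_divide_eq)
    then have "(LINT t:?R|?M. k * \<phi> t) \<le> (LINT t:?R|?M. \<psi> t)"
      using int[OF \<psi>] int[OF \<phi>] by (intro set_integral_mono) auto
    then show ?thesis by simp
  qed
  show "nabla_integral T \<alpha> s \<psi> / nabla_integral T \<alpha> s \<phi>
      \<le> nabla_integral T \<alpha> u \<psi> / nabla_integral T \<alpha> u \<phi>"
    using mediant_le[OF b d a c]
    by (simp add: split[OF \<psi>] split[OF \<phi>] nabla_integral_def[of T \<alpha> s])
qed

theorem theorem2p4:
  fixes T :: "real set" and \<alpha> \<beta> :: real and \<psi> \<phi> :: "real \<Rightarrow> real"
  assumes "time_scale T"
    and "\<alpha> \<in> T" and "\<beta> \<in> T" and "\<alpha> < \<beta>"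
    and "nabla_integrable T \<alpha> \<beta> \<psi>" and "nabla_integrable T \<alpha> \<beta> \<phi>"
    and "\<And>t. t \<in> {\<alpha>..\<beta>} \<inter> T \<Longrightarrow> \<phi> t > 0"
  shows "(mono_on ({\<alpha>..\<beta>} \<inter> T) (\<lambda>t. \<psi> t / \<phi> t) \<longrightarrow>
            mono_on ({\<alpha><..\<beta>} \<inter> T) (\<lambda>s. nabla_integral T \<alpha> s \<psi> / nabla_integral T \<alpha> s \<phi>)) \<and>
         (antimono_on ({\<alpha>..\<beta>} \<inter> T) (\<lambda>t. \<psi> t / \<phi> t) \<longrightarrow>
            antimono_on ({\<alpha><..\<beta>} \<inter> T) (\<lambda>s. nabla_integral T \<alpha> s \<psi> / nabla_integral T \<alpha> s \<phi>))"
proof (intro conjI impI)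
  assume "mono_on ({\<alpha>..\<beta>} \<inter> T) (\<lambda>t. \<psi> t / \<phi> t)"
  with assms show "mono_on ({\<alpha><..\<beta>} \<inter> T)
      (\<lambda>s. nabla_integral T \<alpha> s \<psi> / nabla_integral T \<alpha> s \<phi>)"
    by (intro nabla_integral_ratio_mono)
next
  assume "antimono_on ({\<alpha>..\<beta>} \<inter> T) (\<lambda>t. \<psi> t / \<phi> t)"
  then have "mono_on ({\<alpha>..\<beta>} \<inter> T) (\<lambda>t. - \<psi> t / \<phi> t)"
    by (simp add: monotone_on_def)
  moreover have "nabla_integrable T \<alpha> \<beta> (\<lambda>t. - \<psi> t)"
    using assms(5) by (simp add: nabla_integrable_def set_integrable_def)
  ultimately have "mono_on ({\<alpha><..\<beta>} \<inter> T)
      (\<lambda>s. nabla_integral T \<alpha> s (\<lambda>t. - \<psi> t) / nabla_integral T \<alpha> s \<phi>)"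
    using assms by (intro nabla_integral_ratio_mono)
  \<comment> \<open>The minus sign comes out of the integral and the quotient, and negation reverses
    the order.\<close>
  then show "antimono_on ({\<alpha><..\<beta>} \<inter> T)
      (\<lambda>s. nabla_integral T \<alpha> s \<psi> / nabla_integral T \<alpha> s \<phi>)"
    by (simp add: monotone_on_def nabla_integral_def set_lebesgue_integral_def)
qed

end
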